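(* Let $(K,A,\circ)$ be a crossed semi-bimodule such that $K$ and $A$ are groups. Let $\partial:K\to A$ be the map $\partial(x)=1\circ x$, let $K^{tw}$ be the set $K$ equipped with the operation $x\diamond y:=y\,x^{\partial(y)}$, and let $A$ act on $K^{tw}$ on the right by $x^{*a}={}^{a^{-1}}x^{a}$. Then $(K^{tw},A,\partial)$, with this action, is a crossed module.
   Context: A crossed semi-bimodule $(K,A,\circ)$ consists of monoids $A$ and $K$ (written multiplicatively, units denoted $1$), together with maps $A\times K\to A,\ (a,x)\mapsto a\circ x$; $A\times K\to K,\ (a,x)\mapsto {}^{a}x$; $K\times A\to K,\ (x,a)\mapsto x^{a}$, such that: the first map makes $A$ into a right $K$-set ($a\circ 1=a$, $a\circ(xy)=(a\circ x)\circ y$); the second makes $K$ into a left $A$-monoid (a left action of $A$ on $K$ by monoid endomorphisms: ${}^{1}x=x$, ${}^{ab}x={}^{a}({}^{b}x)$, ${}^{a}(xy)={}^{a}x\,{}^{a}y$, ${}^{a}1=1$); the third makes $K$ into a right $A$-monoid ($x^{1}=x$, $x^{ab}=(x^{a})^{b}$, $(xy)^{a}=x^{a}y^{a}$, $1^{a}=1$); and for all $x,y\in K$, $a,b\in A$: (1) $({}^{a}x)^{b}={}^{a}(x^{b})$; (2) $(ab)\circ({}^{a}x)=a(b\circ x)$; (3) $(ab)\circ(x^{b})=(a\circ x)b$; (4) $({}^{a}y)\,x^{b\circ y}=x^{b}\,({}^{a\circ x}y)$. By (1) the expression ${}^{a}x^{b}$ is unambiguous. A crossed module is a group homomorphism $\partial:G\to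 A$ together with a right action $(x,a)\mapsto x^{a}$ of the group $A$ on the group $G$ (by group automorphisms) such that $\partial(x^{a})=a^{-1}\partial(x)a$ and $y^{\partial x}=x^{-1}yx$ for all $x,y\in G$, $a\in A$. *)

theory Defs
  imports "HOL-Algebra.Group"
begin

text \<open>
  Notation: \<open>circ a x\<close> is $a \circ x$, \<open>lact a x\<close> is ${}^{a}x$ and \<open>ract x a\<close> is $x^{a}$.
\<close>

locale crossed_semi_bimodule = K: monoid K + A: monoid A
  for K :: "('k, 'm) monoid_scheme" (structure) and A :: "('a, 'n) monoid_scheme" (structure) +
  fixes circ :: "'a \<Rightarrow> 'k \<Rightarrow> 'a"
    and lact :: "'a \<Rightarrow> 'k \<Rightarrow> 'k"
    and ract :: "'k \<Rightarrow> 'a \<Rightarrow> 'k"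
  assumes circ_closed: "\<lbrakk>a \<in> carrier A; x \<in> carrier K\<rbrakk> \<Longrightarrow> circ a x \<in> carrier A"
    and circ_one: "a \<in> carrier A \<Longrightarrow> circ a \<one>\<^bsub>K\<^esub> = a"
    and circ_mult: "\<lbrakk>a \<in> carrier A; x \<in> carrier K; y \<in> carrier K\<rbrakk>
          \<Longrightarrow> circ a (x \<otimes>\<^bsub>K\<^esub> y) = circ (circ a x) y"
    and lact_closed: "\<lbrakk>a \<in> carrier A; x \<in> carrier K\<rbrakk> \<Longrightarrow> lact a x \<in> carrier K"
    and lact_one: "x \<in> carrier K \<Longrightarrow> lact \<one>\<^bsub>A\<^esub> x = x"
    and lact_mult: "\<lbrakk>a \<in> carrier A; b \<in> carrier A; x \<in> carrier K\<rbrakk>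
          \<Longrightarrow> lact (a \<otimes>\<^bsub>A\<^esub> b) x = lact a (lact b x)"
    and lact_hom_mult: "\<lbrakk>a \<in> carrier A; x \<in> carrier K; y \<in> carrier K\<rbrakk>
          \<Longrightarrow> lact a (x \<otimes>\<^bsub>K\<^esub> y) = lact a x \<otimes>\<^bsub>K\<^esub> lact a y"
    and lact_hom_one: "a \<in> carrier A \<Longrightarrow> lact a \<one>\<^bsub>K\<^esub> = \<one>\<^bsub>K\<^esub>"
    and ract_closed: "\<lbrakk>x \<in> carrier K; a \<in> carrier A\<rbrakk> \<Longrightarrow> ract x a \<in> carrier K"
    and ract_one: "x \<in> carrier K \<Longrightarrow> ract x \<one>\<^bsub>A\<^esub> = x"
    and ract_mult: "\<lbrakk>x \<in> carrier K; a \<in> carrier A; b \<in> carrier A\<rbrakk>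
          \<Longrightarrow> ract x (a \<otimes>\<^bsub>A\<^esub> b) = ract (ract x a) b"
    and ract_hom_mult: "\<lbrakk>x \<in> carrier K; y \<in> carrier K; a \<in> carrier A\<rbrakk>
          \<Longrightarrow> ract (x \<otimes>\<^bsub>K\<^esub> y) a = ract x a \<otimes>\<^bsub>K\<^esub> ract y a"
    and ract_hom_one: "a \<in> carrier A \<Longrightarrow> ract \<one>\<^bsub>K\<^esub> a = \<one>\<^bsub>K\<^esub>"
    and lact_ract: "\<lbrakk>x \<in> carrier K; a \<in> carrier A; b \<in> carrier A\<rbrakk>
          \<Longrightarrow> ract (lact a x) b = lact a (ract x b)"
    and circ_lact: "\<lbrakk>x \<in> carrier K; a \<in> carrier A; b \<in> carrier A\<rbrakk>
          \<Longrightarrow> circ (a \<otimes>\<^bsub>A\<^esub> b) (lact a x) = a \<otimes>\<^bsub>A\<^esub> circ b x"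
    and circ_ract: "\<lbrakk>x \<in> carrier K; a \<in> carrier A; b \<in> carrier A\<rbrakk>
          \<Longrightarrow> circ (a \<otimes>\<^bsub>A\<^esub> b) (ract x b) = circ a x \<otimes>\<^bsub>A\<^esub> b"
    and exchange: "\<lbrakk>x \<in> carrier K; y \<in> carrier K; a \<in> carrier A; b \<in> carrier A\<rbrakk>
          \<Longrightarrow> lact a y \<otimes>\<^bsub>K\<^esub> ract x (circ b y) = ract x b \<otimes>\<^bsub>K\<^esub> lact (circ a x) y"

locale crossed_module = group_hom G A bd
  for G :: "('g, 'm) monoid_scheme" (structure) and A :: "('a, 'n) monoid_scheme" (structure)
    and bd :: "'g \<Rightarrow> 'a" +
  fixes act :: "'g \<Rightarrow> 'a \<Rightarrow> 'g"
  assumes act_iso: "a \<in> carrier A \<Longrightarrow> (\<lambda>x. act x a) \<in> iso G G"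
    and act_one: "x \<in> carrier G \<Longrightarrow> act x \<one>\<^bsub>A\<^esub> = x"
    and act_mult: "\<lbrakk>x \<in> carrier G; a \<in> carrier A; b \<in> carrier A\<rbrakk>
          \<Longrightarrow> act x (a \<otimes>\<^bsub>A\<^esub> b) = act (act x a) b"
    and equivariant: "\<lbrakk>x \<in> carrier G; a \<in> carrier A\<rbrakk>
          \<Longrightarrow> bd (act x a) = inv\<^bsub>A\<^esub> a \<otimes>\<^bsub>A\<^esub> bd x \<otimes>\<^bsub>A\<^esub> a"
    and peiffer: "\<lbrakk>x \<in> carrier G; y \<in> carrier G\<rbrakk>
          \<Longrightarrow> act y (bd x) = inv\<^bsub>G\<^esub> x \<otimes>\<^bsub>G\<^esub> y \<otimes>\<^bsub>G\<^esub> x"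

definition csb_boundary :: "('a, 'n) monoid_scheme \<Rightarrow> ('a \<Rightarrow> 'k \<Rightarrow> 'a) \<Rightarrow> 'k \<Rightarrow> 'a" where
  "csb_boundary A circ x = circ \<one>\<^bsub>A\<^esub> x"

text \<open>
  The twisted structure is specified by its carrier and product only. The unit field that the
  record type also requires is filled with the unit of \<open>K\<close>; that this is a unit for the
  twisted product is not part of the definition.
\<close>

definition twisted_group ::
  "('k, 'm) monoid_scheme \<Rightarrow> ('a, 'n) monoid_scheme \<Rightarrow> ('a \<Rightarrow> 'k \<Rightarrow> 'a) \<Rightarrow> ('k \<Rightarrow> 'a \<Rightarrow> 'k)
    \<Rightarrow> 'k monoid" where
  "twisted_group K A circ ract =
     \<lparr>carrier = carrier K,
      monoid.mult = (\<lambda>x y. y \<otimes>\<^bsub>K\<^esub> ract x (csb_boundary A circ y)),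
      one = \<one>\<^bsub>K\<^esub>\<rparr>"

definition conj_action ::
  "('a, 'n) monoid_scheme \<Rightarrow> ('a \<Rightarrow> 'k \<Rightarrow> 'k) \<Rightarrow> ('k \<Rightarrow> 'a \<Rightarrow> 'k) \<Rightarrow> 'k \<Rightarrow> 'a \<Rightarrow> 'k" where
  "conj_action A lact ract x a = ract (lact (inv\<^bsub>A\<^esub> a) x) a"

end

theory Submission
  imports Defs
begin

text \<open>
  The twist makes the boundary multiplicative: axiom (3) gives $b \circ x^b = \partial(x)\, b$,
  whence $\partial(y\, x^{\partial y}) = \partial(y) \circ x^{\partial y} = \partial(x)\,\partial(y)$,
  and this makes the twisted product associative. Axioms (2) and (3) together give equivariance,
  and the Peiffer identity is axiom (4) at $a = b = 1$ applied to $x$ and $y^{*\partial x}$.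
\<close>

locale crossed_semi_bimodule_groups =
  crossed_semi_bimodule K A circ lact ract + K: group K + A: group A
  for K :: "('k, 'm) monoid_scheme" (structure) and A :: "('a, 'n) monoid_scheme" (structure)
    and circ lact ract
begin

abbreviation bd :: "'k \<Rightarrow> 'a" where "bd \<equiv> csb_boundary A circ"
abbreviation act :: "'k \<Rightarrow> 'a \<Rightarrow> 'k" where "act \<equiv> conj_action A lact ract"
abbreviation Ktw :: "'k monoid" where "Ktw \<equiv> twisted_group K A circ ract"

lemma carrier_twisted [simp]: "carrier Ktw = carrier K"
  by (simp add: twisted_group_def)

lemma one_twisted [simp]: "\<one>\<^bsub>Ktw\<^esub> = \<one>\<^bsub>K\<^esub>"
  by (simp add: twisted_group_def)

lemma mult_twisted: "x \<otimes>\<^bsub>Ktw\<^esub> y = y \<otimes>\<^bsub>K\<^esub> ract x (bd y)"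
  by (simp add: twisted_group_def)

lemma bd_closed [simp]: "x \<in> carrier K \<Longrightarrow> bd x \<in> carrier A"
  by (simp add: csb_boundary_def circ_closed)

lemma bd_one [simp]: "bd \<one>\<^bsub>K\<^esub> = \<one>\<^bsub>A\<^esub>"
  by (simp add: csb_boundary_def circ_one)

lemma mult_twisted_closed [simp]:
  "\<lbrakk>x \<in> carrier K; y \<in> carrier K\<rbrakk> \<Longrightarrow> x \<otimes>\<^bsub>Ktw\<^esub> y \<in> carrier K"
  by (simp add: mult_twisted ract_closed)

lemma bd_mult_twisted:
  assumes "x \<in> carrier K" "y \<in> carrier K"
  shows "bd (x \<otimes>\<^bsub>Ktw\<^esub> y) = bd x \<otimes>\<^bsub>A\<^esub> bd y"
proof -
  \<comment> \<open>The unit factor is inserted to match the left side of \<open>circ_ract\<close>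
    at a = 1.\<close>
  have "bd (x \<otimes>\<^bsub>Ktw\<^esub> y) = circ (\<one>\<^bsub>A\<^esub> \<otimes>\<^bsub>A\<^esub> bd y) (ract x (bd y))"
    using assms circ_mult[of "\<one>\<^bsub>A\<^esub>" y "ract x (bd y)"] bd_closed[of y]
    by (simp add: mult_twisted csb_boundary_def ract_closed)
  also have "\<dots> = bd x \<otimes>\<^bsub>A\<^esub> bd y"
    using assms circ_ract[of x "\<one>\<^bsub>A\<^esub>" "bd y"] by (simp add: csb_boundary_def circ_closed)
  finally show ?thesis .
qed

lemma group_twisted: "group Ktw"
proof (rule groupI)
  fix x y z assume "x \<in> carrier Ktw" "y \<in> carrier Ktw" "z \<in> carrier Ktw"
  then have xyz: "x \<in> carrier K" "y \<in> carrier K" "z \<in> carrier K" by simp_all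
  have "(x \<otimes>\<^bsub>Ktw\<^esub> y) \<otimes>\<^bsub>Ktw\<^esub> z
      = z \<otimes>\<^bsub>K\<^esub> (ract y (bd z) \<otimes>\<^bsub>K\<^esub> ract x (bd y \<otimes>\<^bsub>A\<^esub> bd z))"
    using xyz by (simp add: mult_twisted ract_hom_mult ract_mult ract_closed)
  \<comment> \<open>Multiplicativity of \<open>bd\<close>, read backwards, merges the exponents of x
    into the boundary of a single twisted product.\<close>
  also have "\<dots> = (y \<otimes>\<^bsub>Ktw\<^esub> z) \<otimes>\<^bsub>K\<^esub> ract x (bd (y \<otimes>\<^bsub>Ktw\<^esub> z))"
    using xyz by (simp add: bd_mult_twisted[symmetric] mult_twisted K.m_assoc ract_closed)
  finally show "(x \<otimes>\<^bsub>Ktw\<^esub> y) \<otimes>\<^bsub>Ktw\<^esub> z = x \<otimes>\<^bsub>Ktw\<^esub> (y \<otimes>\<^bsub>Ktw\<^esub> z)"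
    by (simp add: mult_twisted[of x])
next
  fix x assume "x \<in> carrier Ktw"
  then have x: "x \<in> carrier K" by simp
  \<comment> \<open>The equation to solve reads x y^(bd x) = 1 in K, so y comes from undoing the
    right action of \<open>bd x\<close> on the inverse of x in K.\<close>
  let ?y = "ract (inv\<^bsub>K\<^esub> x) (inv\<^bsub>A\<^esub> bd x)"
  have "ract ?y (bd x) = inv\<^bsub>K\<^esub> x"
    using x by (simp add: ract_mult[symmetric] ract_one)
  then have "?y \<otimes>\<^bsub>Ktw\<^esub> x = \<one>\<^bsub>Ktw\<^esub>"
    using x by (simp add: mult_twisted)
  then show "\<exists>y\<in>carrier Ktw. y \<otimes>\<^bsub>Ktw\<^esub> x = \<one>\<^bsub>Ktw\<^esub>"
    using x by (intro bexI[of _ ?y]) (simp_all add: ract_closed)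
qed (simp_all add: mult_twisted ract_closed ract_hom_one)

lemma act_closed [simp]: "\<lbrakk>x \<in> carrier K; a \<in> carrier A\<rbrakk> \<Longrightarrow> act x a \<in> carrier K"
  by (simp add: conj_action_def lact_closed ract_closed)

lemma act_one: "x \<in> carrier K \<Longrightarrow> act x \<one>\<^bsub>A\<^esub> = x"
  by (simp add: conj_action_def lact_one ract_one)

text \<open>Inversion reverses products in A and so turns the left action into a right one; axiom
  (1) lets it pass the genuine right action.\<close>

lemma act_mult:
  "\<lbrakk>x \<in> carrier K; a \<in> carrier A; b \<in> carrier A\<rbrakk> \<Longrightarrow> act x (a \<otimes>\<^bsub>A\<^esub> b) = act (act x a) b"
  by (simp add: conj_action_def A.inv_mult_group lact_mult ract_mult lact_ract
      lact_closed ract_closed)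

lemma bd_act:
  assumes "x \<in> carrier K" "a \<in> carrier A"
  shows "bd (act x a) = inv\<^bsub>A\<^esub> a \<otimes>\<^bsub>A\<^esub> bd x \<otimes>\<^bsub>A\<^esub> a"
proof -
  \<comment> \<open>The base point 1 is split as a^-1 a, so that \<open>circ_ract\<close> strips the
    right action; rewriting a^-1 as a^-1 1 then lets \<open>circ_lact\<close> strip the left
    one.\<close>
  have "bd (act x a) = circ (inv\<^bsub>A\<^esub> a \<otimes>\<^bsub>A\<^esub> a) (ract (lact (inv\<^bsub>A\<^esub> a) x) a)"
    using assms by (simp add: csb_boundary_def conj_action_def)
  also have "\<dots> = circ (inv\<^bsub>A\<^esub> a \<otimes>\<^bsub>A\<^esub> \<one>\<^bsub>A\<^esub>) (lact (inv\<^bsub>A\<^esub> a) x) \<otimes>\<^bsub>A\<^esub> a"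
    using assms by (subst circ_ract) (simp_all add: lact_closed)
  also have "\<dots> = inv\<^bsub>A\<^esub> a \<otimes>\<^bsub>A\<^esub> bd x \<otimes>\<^bsub>A\<^esub> a"
    using assms by (subst circ_lact) (simp_all add: csb_boundary_def)
  finally show ?thesis .
qed

text \<open>Equivariance of \<open>bd\<close> is what absorbs the twist: acting by a and then by the
  boundary of \<open>act y a\<close> amounts to acting by \<open>bd y\<close> first and by a
  afterwards.\<close>

lemma act_mult_twisted:
  assumes "x \<in> carrier K" "y \<in> carrier K" "a \<in> carrier A"
  shows "act (x \<otimes>\<^bsub>Ktw\<^esub> y) a = act x a \<otimes>\<^bsub>Ktw\<^esub> act y a"
proof -
  let ?x = "lact (inv\<^bsub>A\<^esub> a) x"
  have "a \<otimes>\<^bsub>A\<^esub> bd (act y a) = bd y \<otimes>\<^bsub>A\<^esub> a"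
    using assms by (simp add: bd_act A.m_assoc[symmetric])
  then have "ract (act x a) (bd (act y a)) = ract ?x (bd y \<otimes>\<^bsub>A\<^esub> a)"
    using assms by (simp add: conj_action_def[of _ _ _ x] ract_mult[symmetric] lact_closed)
  also have "\<dots> = act (ract x (bd y)) a"
    using assms by (simp add: conj_action_def ract_mult lact_closed lact_ract)
  finally show ?thesis
    using assms
    \<comment> \<open>The first \<open>simp\<close> uses the equation just derived while
      \<open>act\<close> is still folded; the second unfolds \<open>act\<close> and uses that both
      one-sided actions respect the product of K.\<close>
    by (simp add: mult_twisted) (simp add: conj_action_def lact_hom_mult ract_hom_mult
        lact_closed ract_closed)
qed

lemma act_iso:
  assumes "a \<in> carrier A"
  shows "(\<lambda>x. act x a) \<in> iso Ktw Ktw"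
proof -
  have "bij_betw (\<lambda>x. act x a) (carrier K) (carrier K)"
    by (rule bij_betw_byWitness[where f' = "\<lambda>x. act x (inv\<^bsub>A\<^esub> a)"])
      (use assms in \<open>auto simp: act_mult[symmetric] act_one\<close>)
  then show ?thesis
    using assms by (auto simp: iso_def hom_def act_mult_twisted)
qed

text \<open>This is the Peiffer identity cleared of its inverse, so that no inverse in
  \<open>Ktw\<close> has to be computed.\<close>

lemma twisted_mult_act_bd:
  assumes "x \<in> carrier K" "y \<in> carrier K"
  shows "x \<otimes>\<^bsub>Ktw\<^esub> act y (bd x) = y \<otimes>\<^bsub>Ktw\<^esub> x"
proof -
  let ?y = "act y (bd x)"
  have "x \<otimes>\<^bsub>Ktw\<^esub> ?y = x \<otimes>\<^bsub>K\<^esub> lact (bd x) ?y"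
    using assms exchange[of x ?y "\<one>\<^bsub>A\<^esub>" "\<one>\<^bsub>A\<^esub>"]
    by (simp add: mult_twisted lact_one ract_one csb_boundary_def[symmetric])
  \<comment> \<open>The left action of \<open>bd x\<close> cancels the inverse hidden in
    \<open>act\<close>, and what remains is the twisting factor of the product of y and x.\<close>
  also have "lact (bd x) ?y = ract y (bd x)"
    using assms
    by (simp add: conj_action_def lact_ract[symmetric] lact_mult[symmetric] lact_closed lact_one)
  finally show ?thesis
    by (simp add: mult_twisted)
qed

lemma crossed_module_twisted: "crossed_module Ktw A bd act"
proof -
  interpret T: group Ktw by (rule group_twisted)
  show ?thesis
  proof unfold_locales
    show "bd \<in> hom Ktw A" by (simp add: hom_def bd_mult_twisted)
  next
    fix x y assume "x \<in> carrier Ktw" "y \<in> carrier Ktw"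
    then show "act y (bd x) = inv\<^bsub>Ktw\<^esub> x \<otimes>\<^bsub>Ktw\<^esub> y \<otimes>\<^bsub>Ktw\<^esub> x"
      using twisted_mult_act_bd[of x y]
      by (metis T.inv_solve_left' T.m_assoc T.inv_closed T.m_closed act_closed bd_closed carrier_twisted)
  qed (simp_all add: act_iso act_one act_mult bd_act)
qed

end

theorem corollary5p4:
  fixes K :: "('k, 'm) monoid_scheme" and A :: "('a, 'n) monoid_scheme"
    and circ :: "'a \<Rightarrow> 'k \<Rightarrow> 'a" and lact :: "'a \<Rightarrow> 'k \<Rightarrow> 'k" and ract :: "'k \<Rightarrow> 'a \<Rightarrow> 'k"
  assumes "crossed_semi_bimodule K A circ lact ract"
    and "group K" and "group A"
  shows "crossed_module (twisted_group K A circ ract) A (csb_boundary A circ)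
           (conj_action A lact ract)"
proof -
  interpret crossed_semi_bimodule_groups K A circ lact ract
    using assms by (simp add: crossed_semi_bimodule_groups_def)
  show ?thesis by (rule crossed_module_twisted)
qed

end
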